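(* Let $m$ be an odd positive integer and let $a_1,\dots,a_m\ge2$ be integers, and let $N=\min\{a_1,a_2,\dots,a_m\}$. Then \[R_{C_m}(a_1,a_2,\dots,a_m)=R_{C_m}(N,N,\dots,N).\]
   Context: $C_m\le S_m$ denotes the cyclic group generated by the $m$-cycle $(1\,2\,\cdots\,m)$. An $m$-edge-coloured complete graph is a complete graph with each edge coloured from $[m]=\{1,\dots,m\}$. For $\Gamma\le S_m$, $\pi\in\Gamma$ and a vertex $v$, switching at $v$ with $\pi$ recolours every edge incident with $v$ of colour $i$ to colour $\pi(i)$, leaving other edges unchanged. Two such graphs on the same vertex set are $\Gamma$-switch equivalent if one is obtained from the other by a finite sequence of switches. $K_t^{(i)}$ is a complete graph on $t$ vertices with all edges of colour $i$. $R_\Gamma(a_1,\dots,a_m)$ is the least $n$ such that every $m$-edge-coloured complete graph on $n$ vertices is $\Gamma$-switch equivalent to one containing, for some $i$, a copy of $K_{a_i}^{(i)}$. *)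

theory Defs
  imports "HOL-Algebra.Sym_Groups" "HOL-Library.Ramsey"
begin

(* For m = 1 the generator is the identity, so the group is trivial. *)
definition cyclic_perm_group :: "nat \<Rightarrow> (nat \<Rightarrow> nat) set" where
  "cyclic_perm_group m = generate (sym_group m) {cycle_of_list [1..<m+1]}"

lemma cyclic_perm_group_subgroup: "subgroup (cyclic_perm_group m) (sym_group m)"
proof -
  have "set [1..<m+1] = {1..m}" by auto
  then have "cycle_of_list [1..<m+1] \<in> carrier (sym_group m)"
    using cycle_permutes[of "[1..<m+1]"] by (metis sym_group_carrier)
  then show ?thesis
    unfolding cyclic_perm_group_def
    by (intro group.generate_is_subgroup sym_group_is_group) simp
qed

(* The m-edge-coloured complete graphs with vertex set V.  The edges are the two-element subsets
   of V; colourings are extensional (undefined off the edges), so that equality of functions is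
   equality of coloured graphs. *)
definition edge_colourings :: "'v set \<Rightarrow> nat \<Rightarrow> ('v set \<Rightarrow> nat) set" where
  "edge_colourings V m = nsets V 2 \<rightarrow>\<^sub>E {1..m}"

definition switch :: "'v set \<Rightarrow> 'v \<Rightarrow> (nat \<Rightarrow> nat) \<Rightarrow> ('v set \<Rightarrow> nat) \<Rightarrow> 'v set \<Rightarrow> nat" where
  "switch V v \<pi> c = (\<lambda>e. if e \<in> nsets V 2 \<and> v \<in> e then \<pi> (c e) else c e)"

definition switch_step ::
  "(nat \<Rightarrow> nat) set \<Rightarrow> 'v set \<Rightarrow> ('v set \<Rightarrow> nat) \<Rightarrow> ('v set \<Rightarrow> nat) \<Rightarrow> bool" where
  "switch_step \<Gamma> V c c' \<longleftrightarrow> (\<exists>v\<in>V. \<exists>\<pi>\<in>\<Gamma>. c' = switch V v \<pi> c)"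

definition switch_equiv ::
  "(nat \<Rightarrow> nat) set \<Rightarrow> 'v set \<Rightarrow> ('v set \<Rightarrow> nat) \<Rightarrow> ('v set \<Rightarrow> nat) \<Rightarrow> bool" where
  "switch_equiv \<Gamma> V = (switch_step \<Gamma> V)\<^sup>*\<^sup>*"

definition contains_mono_complete :: "'v set \<Rightarrow> ('v set \<Rightarrow> nat) \<Rightarrow> nat \<Rightarrow> nat \<Rightarrow> bool" where
  "contains_mono_complete V c t i \<longleftrightarrow> (\<exists>W \<in> nsets V t. \<forall>e \<in> nsets W 2. c e = i)"

(* Every finite graph is isomorphic to one whose vertices are natural numbers. *)
definition switch_ramsey_property :: "nat \<Rightarrow> (nat \<Rightarrow> nat) set \<Rightarrow> (nat \<Rightarrow> nat) \<Rightarrow> nat \<Rightarrow> bool" where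
  "switch_ramsey_property m \<Gamma> a n \<longleftrightarrow>
     (\<forall>V :: nat set. finite V \<and> card V = n \<longrightarrow>
       (\<forall>c \<in> edge_colourings V m. \<exists>c'. switch_equiv \<Gamma> V c c' \<and>
          (\<exists>i \<in> {1..m}. contains_mono_complete V c' (a i) i)))"

(* The parameters a_1, ..., a_m are the values of a on {1..m}; other values are irrelevant. *)
definition switch_ramsey :: "nat \<Rightarrow> (nat \<Rightarrow> nat) set \<Rightarrow> (nat \<Rightarrow> nat) \<Rightarrow> nat" where
  "switch_ramsey m \<Gamma> a = (LEAST n. switch_ramsey_property m \<Gamma> a n)"

(* By Ramsey's theorem the minimum is taken over a nonempty set. *)
lemma switch_ramsey_property_ex: "\<exists>n. switch_ramsey_property m \<Gamma> a n"
proof -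
  obtain n :: nat where n: "partn_lst {..<n} (map (\<lambda>k. a (Suc k)) [0..<m]) 2"
    using ramsey_full by blast
  have "switch_ramsey_property m \<Gamma> a n"
    unfolding switch_ramsey_property_def
  proof (intro allI impI ballI)
    fix V :: "nat set" and c
    assume V: "finite V \<and> card V = n" and c: "c \<in> edge_colourings V m"
    obtain f where f: "bij_betw f {..<n} V"
      using V by (metis card_lessThan finite_lessThan finite_same_card_bij)
    then have inj: "inj_on f {..<n}" and im: "f ` {..<n} = V"
      by (auto simp: bij_betw_def)
    have edge: "f ` A \<in> nsets V k" if "A \<in> nsets {..<n} k" for A k
      using that inj im card_image[of f A] inj_on_subset[OF inj, of A]
      unfolding nsets_def by auto
    define d where "d A = c (f ` A) - 1" for A
    have "c (f ` A) \<in> {1..m}" if "A \<in> nsets {..<n} 2" for A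
      using c edge[OF that] unfolding edge_colourings_def by blast
    then have pos: "c (f ` A) = Suc (d A)" "d A < m" if "A \<in> nsets {..<n} 2" for A
      using that by (fastforce simp: d_def)+
    then have "d \<in> nsets {..<n} 2 \<rightarrow> {..<m}" by auto
    then obtain i H where i: "i < m" and H: "H \<in> nsets {..<n} (a (Suc i))"
      and Hi: "d ` nsets H 2 \<subseteq> {i}"
      using partn_lstE[OF n, of d m] by auto
    have "c e = Suc i" if e: "e \<in> nsets (f ` H) 2" for e
    proof -
      have "e \<subseteq> f ` H"
        using e by (simp add: nsets_def)
      then obtain A where A: "A \<subseteq> H" "e = f ` A"
        by (rule subset_imageE)
      have injA: "inj_on f A" "A \<subseteq> {..<n}"
        using A H inj_on_subset[OF inj, of A] unfolding nsets_def by auto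
      have "finite A" "card A = 2"
        using e A(2) card_image[OF injA(1)] finite_subset[OF injA(2)]
        by (simp_all add: nsets_def)
      then have "A \<in> nsets H 2" "A \<in> nsets {..<n} 2"
        using A(1) injA(2) by (simp_all add: nsets_def)
      then show ?thesis using Hi pos[of A] A(2) by (auto simp: image_subset_iff)
    qed
    then have "contains_mono_complete V c (a (Suc i)) (Suc i)"
      unfolding contains_mono_complete_def using edge[OF H] by blast
    then show "\<exists>c'. switch_equiv \<Gamma> V c c' \<and> (\<exists>i\<in>{1..m}. contains_mono_complete V c' (a i) i)"
      using i unfolding switch_equiv_def
      by (intro exI[of _ c] conjI bexI[of _ "Suc i"]) auto
  qed
  then show ?thesis ..
qed

end

theory Submission
  imports Defs
begin

text \<open>
  Identify the colours with the integers modulo m. Switching every vertex of a set W by the k-th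
  power of the generator adds 2k to the colour of each edge inside W. As m is odd, 2 is invertible
  modulo m, so a monochromatic clique of any colour can be switched to any prescribed colour, in
  particular to one whose parameter is the minimum N.
\<close>

lemma funpow_mem_cyclic_perm_group:
  "(cycle_of_list [1..<m+1]) ^^ k \<in> cyclic_perm_group m"
proof (induction k)
  case 0
  then show ?case
    using generate.one[of "sym_group m"]
    unfolding cyclic_perm_group_def sym_group_one funpow.simps .
next
  case (Suc k)
  have "cycle_of_list [1..<m+1] \<in> cyclic_perm_group m"
    unfolding cyclic_perm_group_def by (rule generate.incl) simp
  from generate.eng[OF this[unfolded cyclic_perm_group_def] Suc[unfolded cyclic_perm_group_def]]
  show ?case
    unfolding cyclic_perm_group_def sym_group_mult funpow.simps .
qed

text \<open>Iterating the cycle along its own list rotates the list, and colour \<open>i\<close>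
  sits at position \<open>i - 1\<close>. The shifts by one translate between colours, which start at
  1, and residues modulo \<open>m\<close>.\<close>

lemma funpow_cycle_upt:
  assumes "i \<in> {1..m}"
  shows "((cycle_of_list [1..<m+1]) ^^ k) i = (i - 1 + k) mod m + 1"
proof -
  let ?cs = "[1..<m+1]"
  have "map ((cycle_of_list ?cs) ^^ k) ?cs ! (i - 1) = rotate k ?cs ! (i - 1)"
    by (subst cyclic_rotation) simp_all
  moreover have "m > 0" "i - 1 < m" using assms by auto
  ultimately show ?thesis
    using assms by (simp add: nth_rotate add.commute del: upt_Suc)
qed

text \<open>The permutation is applied twice because an edge inside a clique is switched once at
  each of its two ends.\<close>

lemma cyclic_perm_group_square_transitive:
  assumes "odd m" and i: "i \<in> {1..m}" and j: "j \<in> {1..m}"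
  obtains \<pi> where "\<pi> \<in> cyclic_perm_group m" "\<pi> (\<pi> i) = j"
proof -
  \<comment> \<open>\<open>(m + 1) div 2\<close> is the inverse of 2 modulo \<open>m\<close>; adding \<open>m\<close> avoids truncated subtraction.\<close>
  define d where "d = j + m - i"
  define k where "k = d * ((m + 1) div 2)"
  have "k + k = d * ((m + 1) div 2 * 2)"
    by (simp add: k_def)
  also have "(m + 1) div 2 * 2 = m + 1"
    using \<open>odd m\<close> by presburger
  finally have "k + k = d * m + d"
    by simp
  then have "i - 1 + (k + k) = (j - 1) + (d + 1) * m"
    using i j by (simp add: d_def)
  then have "(i - 1 + (k + k)) mod m = j - 1"
    using j by (simp only: mod_mult_self1) auto
  then have "((cycle_of_list [1..<m+1]) ^^ (k + k)) i = j"
    using funpow_cycle_upt[OF i, of "k + k"] j by simp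
  then show ?thesis
    by (intro that[OF funpow_mem_cyclic_perm_group]) (simp add: funpow_add)
qed

text \<open>Switch at the vertices of \<open>X\<close> one after another, always with the same
  \<open>\<pi>\<close>: the exponent counts the ends of \<open>e\<close> that lie in
  \<open>X\<close>.\<close>

lemma switch_equiv_switch_set:
  assumes "finite X" "X \<subseteq> V" "\<pi> \<in> \<Gamma>"
  shows "switch_equiv \<Gamma> V c
    (\<lambda>e. if e \<in> nsets V 2 then (\<pi> ^^ card (e \<inter> X)) (c e) else c e)"
  using assms
proof (induction X rule: finite_induct)
  case empty
  then show ?case by (simp add: switch_equiv_def cong: if_cong)
next
  case (insert v X)
  let ?d = "\<lambda>X e. if e \<in> nsets V 2 then (\<pi> ^^ card (e \<inter> X)) (c e) else c e"
  have "?d (insert v X) = switch V v \<pi> (?d X)"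
    using insert.hyps by (auto simp: switch_def fun_eq_iff Int_insert_right)
  then have "switch_step \<Gamma> V (?d X) (?d (insert v X))"
    using insert.prems unfolding switch_step_def by blast
  then show ?case
    using insert unfolding switch_equiv_def by (simp add: rtranclp.rtrancl_into_rtrancl)
qed

lemma contains_mono_complete_mono:
  assumes "contains_mono_complete V c t i" "s \<le> t"
  shows "contains_mono_complete V c s i"
proof -
  obtain W where W: "W \<subseteq> V" "card W = t" and mono: "\<forall>e \<in> nsets W 2. c e = i"
    using assms(1) by (auto simp: contains_mono_complete_def nsets_def)
  obtain U where U: "U \<subseteq> W" "card U = s" "finite U"
    using obtain_subset_with_card_n[of s W] W \<open>s \<le> t\<close> by auto
  then have "U \<in> nsets V s" "nsets U 2 \<subseteq> nsets W 2"
    using W by (auto simp: nsets_def)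
  then show ?thesis
    using mono by (auto simp: contains_mono_complete_def)
qed

lemma switch_to_colour:
  assumes "odd m" "i \<in> {1..m}" "j \<in> {1..m}" "contains_mono_complete V c t i"
  obtains c' where "switch_equiv (cyclic_perm_group m) V c c'" "contains_mono_complete V c' t j"
proof -
  obtain W where W: "W \<in> nsets V t" and mono: "\<forall>e \<in> nsets W 2. c e = i"
    using assms(4) by (auto simp: contains_mono_complete_def)
  obtain \<pi> where \<pi>: "\<pi> \<in> cyclic_perm_group m" "\<pi> (\<pi> i) = j"
    using cyclic_perm_group_square_transitive assms(1-3) by blast
  let ?d = "\<lambda>e. if e \<in> nsets V 2 then (\<pi> ^^ card (e \<inter> W)) (c e) else c e"
  have "?d e = j" if e: "e \<in> nsets W 2" for e
  proof -
    \<comment> \<open>Both ends of \<open>e\<close> lie in \<open>W\<close>, so the exponent is 2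
      and the new colour is \<open>\<pi> (\<pi> i)\<close>.\<close>
    have "e \<inter> W = e" "card e = 2" "e \<in> nsets V 2"
      using e W by (auto simp: nsets_def)
    then show ?thesis using mono e \<pi>(2) by (simp add: numeral_2_eq_2)
  qed
  then have "contains_mono_complete V ?d t j"
    unfolding contains_mono_complete_def using W by blast
  moreover have "switch_equiv (cyclic_perm_group m) V c ?d"
    using W \<pi>(1) by (intro switch_equiv_switch_set) (auto simp: nsets_def)
  ultimately show ?thesis using that by blast
qed

theorem theorem22:
  fixes m :: nat and a :: "nat \<Rightarrow> nat" and N :: nat
  assumes "odd m"
    and "\<And>i. i \<in> {1..m} \<Longrightarrow> a i \<ge> 2"
    and "N = Min (a ` {1..m})"
  shows "switch_ramsey m (cyclic_perm_group m) a = switch_ramsey m (cyclic_perm_group m) (\<lambda>_. N)"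
proof -
  let ?\<Gamma> = "cyclic_perm_group m"
  have "m \<noteq> 0" using \<open>odd m\<close> by (cases m) auto
  then have "N \<in> a ` {1..m}"
    unfolding assms(3) by (intro Min_in) auto
  then obtain j where j: "j \<in> {1..m}" "a j = N" by auto
  have N_le: "N \<le> a i" if "i \<in> {1..m}" for i
    using that assms(3) by simp
  \<comment> \<open>The equivalence holds for each colouring separately, so both Ramsey properties
    hold for the same \<open>n\<close> and have the same least element.\<close>
  have "(\<exists>c'. switch_equiv ?\<Gamma> V c c' \<and> (\<exists>i \<in> {1..m}. contains_mono_complete V c' (a i) i))
    \<longleftrightarrow> (\<exists>c'. switch_equiv ?\<Gamma> V c c' \<and> (\<exists>i \<in> {1..m}. contains_mono_complete V c' N i))"
    (is "?A \<longleftrightarrow> ?B") for V :: "nat set" and c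
  proof
    assume ?A
    then show ?B using N_le contains_mono_complete_mono by blast
  next
    assume ?B
    then obtain c' i where c': "switch_equiv ?\<Gamma> V c c'" and "i \<in> {1..m}"
      "contains_mono_complete V c' N i" by blast
    \<comment> \<open>The colour \<open>i\<close> of the clique is arbitrary; further switching
      moves it to \<open>j\<close>, where the minimum is attained and size \<open>N\<close>
      suffices.\<close>
    then obtain c'' where "switch_equiv ?\<Gamma> V c' c''" "contains_mono_complete V c'' (a j) j"
      using switch_to_colour[OF \<open>odd m\<close>] j by metis
    then show ?A
      using c' j(1) unfolding switch_equiv_def by (meson rtranclp_trans)
  qed
  then show ?thesis
    unfolding switch_ramsey_def switch_ramsey_property_def by simp
qed

end
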